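(* For every positive integer $k$, $$\operatorname{RR}\bigl(x+y+z+kv=(k+2)w\bigr)=\operatorname{RR}\bigl(x+y+z+kv=(k+4)w\bigr)=4.$$
   Context: For a linear equation $\mathcal{E}$ in positive-integer variables, the 2-color Rado number $\operatorname{RR}(\mathcal{E})$ is the least positive integer $N$, if it exists, such that every 2-coloring of $[1,N]=\{1,\ldots,N\}$ admits a solution of $\mathcal{E}$ in $[1,N]$ all of whose variables take values (not necessarily distinct) of the same color. *)

theory Defs
  imports Main
begin

text \<open>
  \<^term>\<open>Lin_Eq as b\<close> stands for the linear equation
  \<open>as ! 0 * x\<^sub>0 + \<dots> + as ! (n - 1) * x\<^sub>n\<^sub>-\<^sub>1 = b\<close> in \<open>n = length as\<close> variables,
  all terms with a variable being brought to the left-hand side.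
\<close>

datatype lin_eq = Lin_Eq (coeffs: "int list") (rhs: int)

definition is_solution :: "lin_eq \<Rightarrow> nat list \<Rightarrow> bool" where
  "is_solution E xs \<longleftrightarrow>
     length xs = length (coeffs E) \<and> (\<Sum>i<length xs. coeffs E ! i * int (xs ! i)) = rhs E"

text \<open>
  A 2-coloring of \<open>{1..N}\<close> is represented by a total function to \<^typ>\<open>bool\<close>,
  whose values outside \<open>{1..N}\<close> are never inspected.
\<close>

definition has_mono_solution :: "lin_eq \<Rightarrow> nat \<Rightarrow> (nat \<Rightarrow> bool) \<Rightarrow> bool" where
  "has_mono_solution E N \<chi> \<longleftrightarrow>
     (\<exists>xs. is_solution E xs \<and> set xs \<subseteq> {1..N} \<and> (\<exists>c. \<forall>x\<in>set xs. \<chi> x = c))"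

definition rado_property :: "lin_eq \<Rightarrow> nat \<Rightarrow> bool" where
  "rado_property E N \<longleftrightarrow> (\<forall>\<chi>. has_mono_solution E N \<chi>)"

text \<open>The 2-color Rado number; \<^const>\<open>None\<close> means that it does not exist.\<close>

definition RR :: "lin_eq \<Rightarrow> nat option" where
  "RR E =
     (if \<exists>N\<ge>1. rado_property E N then Some (LEAST N. N \<ge> 1 \<and> rado_property E N) else None)"

end

theory Submission
  imports Defs
begin

text \<open>
  For \<open>v = w\<close> the equation \<open>x + y + z + kv = (k + c)w\<close> becomes \<open>x + y + z = cw\<close>, whose solutions in
  \<open>[1,4]\<close> already defeat every coloring if \<open>c\<close> is 2 or 4. Conversely, for even \<open>c\<close> the coloring by parity is free of odd
  solutions, and the only even number in \<open>[1,3]\<close> is 2, which gives no constant solution unless \<open>c = 3\<close>.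
\<close>

lemma is_solution_five:
  "is_solution (Lin_Eq [1, 1, 1, a, b] d) xs \<longleftrightarrow>
     (\<exists>x y z v w. xs = [x, y, z, v, w] \<and> int x + int y + int z + a * int v + b * int w = d)"
proof -
  have five: "{..<Suc (Suc (Suc (Suc (Suc 0))))} = {0, 1, 2, 3, 4}"
    by auto
  have *: "is_solution (Lin_Eq [1, 1, 1, a, b] d) [x, y, z, v, w] \<longleftrightarrow>
      int x + int y + int z + a * int v + b * int w = d" for x y z v w
    by (simp add: is_solution_def five add.assoc)
  have "\<exists>x y z v w. xs = [x, y, z, v, w]" if "is_solution (Lin_Eq [1, 1, 1, a, b] d) xs"
    using that by (auto simp: is_solution_def length_Suc_conv)
  with * show ?thesis
    by metis
qed

text \<open>The variables \<open>v\<close> and \<open>w\<close> share one value, so the terms with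
  \<open>k\<close> cancel and one choice of \<open>x\<close>, \<open>y\<close>, \<open>z\<close>,
  \<open>w\<close> serves every \<open>k\<close>. The common color is that of
  \<open>w\<close>.\<close>

lemma has_mono_solutionI:
  assumes "x + y + z = c * w" "{x, y, z, w} \<subseteq> {1..N}" "\<chi> x = \<chi> w" "\<chi> y = \<chi> w" "\<chi> z = \<chi> w"
  shows "has_mono_solution (Lin_Eq [1, 1, 1, int k, - (int k + int c)] 0) N \<chi>"
proof -
  have "int x + int y + int z = int c * int w"
    using assms(1) by (metis of_nat_add of_nat_mult)
  then have "is_solution (Lin_Eq [1, 1, 1, int k, - (int k + int c)] 0) [x, y, z, w, w]"
    by (simp add: is_solution_five algebra_simps)
  then show ?thesis
    unfolding has_mono_solution_def using assms(2-) by (intro exI[of _ "[x, y, z, w, w]"]) auto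
qed

lemma parity_coloring_not_mono:
  assumes "even c" "N \<le> 3"
  shows "\<not> has_mono_solution (Lin_Eq [1, 1, 1, int k, - (int k + int c)] 0) N even"
proof
  assume "has_mono_solution (Lin_Eq [1, 1, 1, int k, - (int k + int c)] 0) N even"
  then obtain xs p where "is_solution (Lin_Eq [1, 1, 1, int k, - (int k + int c)] 0) xs"
    and xs: "set xs \<subseteq> {1..N}" "\<forall>x\<in>set xs. even x = p"
    unfolding has_mono_solution_def by blast
  then obtain x y z v w
    where eq: "int x + int y + int z + int k * int v + - (int k + int c) * int w = 0"
      and "xs = [x, y, z, v, w]"
    unfolding is_solution_five by blast
  with xs assms(2) have range: "{x, y, z, v, w} \<subseteq> {1..3}"
    and p: "even x = p" "even y = p" "even z = p" "even v = p" "even w = p"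
    by auto
  show False
  proof (cases p)
    case True
    have "n = 2" if "even n" "n \<in> {1..3}" for n :: nat
      using that by (cases "n = 1"; cases "n = 3") auto
    then have "x = 2" "y = 2" "z = 2" "v = 2" "w = 2"
      using range p True by auto
    \<comment> \<open>With every variable equal to 2, \<open>eq\<close> reads 6 + 2k - 2(k + c) =
      0.\<close>
    with eq have "int c = 3"
      by (simp add: algebra_simps)
    with assms(1) show False
      by simp
  next
    case False
    \<comment> \<open>Count modulo 2: if all five variables are odd, the left-hand side has the
      parity of 3 + k - (k + c) = 3 - c, which is odd for even \<open>c\<close>, while 0 is
      even.\<close>
    have "even (int x + int y + int z + int k * int v + - (int k + int c) * int w)"
      unfolding eq by simp
    moreover have "odd x" "odd y" "odd z" "odd v" "odd w"
      using p False by auto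
    ultimately show False
      using assms(1) by simp
  qed
qed

lemma RR_eq_Some_4:
  assumes "even c" "rado_property (Lin_Eq [1, 1, 1, int k, - (int k + int c)] 0) 4"
  shows "RR (Lin_Eq [1, 1, 1, int k, - (int k + int c)] 0) = Some 4"
proof -
  let ?E = "Lin_Eq [1, 1, 1, int k, - (int k + int c)] 0"
  \<comment> \<open>The one parity coloring refutes every \<open>N\<close> below 4 at once, as
    minimality in \<open>LEAST\<close> demands.\<close>
  have "4 \<le> N" if "rado_property ?E N" for N
  proof (rule ccontr)
    assume "\<not> 4 \<le> N"
    then have "N \<le> 3"
      by simp
    with that parity_coloring_not_mono[OF assms(1)] show False
      unfolding rado_property_def by blast
  qed
  then have "(LEAST N. N \<ge> 1 \<and> rado_property ?E N) = 4"
    using assms(2) by (intro Least_equality) auto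
  moreover have "\<exists>N\<ge>1. rado_property ?E N"
    using assms(2) by (intro exI[of _ 4]) simp
  ultimately show ?thesis
    by (simp add: RR_def)
qed

lemma rado_property_2: "rado_property (Lin_Eq [1, 1, 1, int k, - (int k + int 2)] 0) 4"
  unfolding rado_property_def
proof
  fix \<chi> :: "nat \<Rightarrow> bool"
  note mono = has_mono_solutionI[of _ _ _ 2 _ 4 \<chi> k]
  \<comment> \<open>If 2 shares its color with none of 1, 3, 4, these three all have the other
    color. The cases use, in order, 1 + 1 + 2 = 2 * 2, 2 + 2 + 2 = 2 * 3, 2 + 2 + 4 = 2 * 4 and 1 +
    3 + 4 = 2 * 4.\<close>
  consider "\<chi> 1 = \<chi> 2" | "\<chi> 2 = \<chi> 3" | "\<chi> 2 = \<chi> 4" | "\<chi> 1 = \<chi> 4" "\<chi> 3 = \<chi> 4"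
    by blast
  then show "has_mono_solution (Lin_Eq [1, 1, 1, int k, - (int k + int 2)] 0) 4 \<chi>"
  proof cases
    case 1 then show ?thesis by (intro mono[of 1 1 2 2]) simp_all
  next
    case 2 then show ?thesis by (intro mono[of 2 2 2 3]) simp_all
  next
    case 3 then show ?thesis by (intro mono[of 2 2 4 4]) simp_all
  next
    case 4 then show ?thesis by (intro mono[of 1 3 4 4]) simp_all
  qed
qed

lemma rado_property_4: "rado_property (Lin_Eq [1, 1, 1, int k, - (int k + int 4)] 0) 4"
  unfolding rado_property_def
proof
  fix \<chi> :: "nat \<Rightarrow> bool"
  note mono = has_mono_solutionI[of _ _ _ 4 _ 4 \<chi> k]
  \<comment> \<open>By pigeonhole two of 2, 3, 4 share a color, and each pair carries a solution: 3
    + 3 + 2 = 4 * 2, 2 + 2 + 4 = 4 * 2, 4 + 4 + 4 = 4 * 3.\<close>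
  consider "\<chi> 2 = \<chi> 3" | "\<chi> 2 = \<chi> 4" | "\<chi> 3 = \<chi> 4"
    by blast
  then show "has_mono_solution (Lin_Eq [1, 1, 1, int k, - (int k + int 4)] 0) 4 \<chi>"
  proof cases
    case 1 then show ?thesis by (intro mono[of 3 3 2 2]) simp_all
  next
    case 2 then show ?thesis by (intro mono[of 2 2 4 2]) simp_all
  next
    case 3 then show ?thesis by (intro mono[of 4 4 4 3]) simp_all
  qed
qed

theorem theorem4p1:
  fixes k :: nat
  assumes "k \<ge> 1"
  shows "RR (Lin_Eq [1, 1, 1, int k, - (int k + 2)] 0) = Some 4
       \<and> RR (Lin_Eq [1, 1, 1, int k, - (int k + 4)] 0) = Some 4"
  using RR_eq_Some_4[OF _ rado_property_2[of k]] RR_eq_Some_4[OF _ rado_property_4[of k]] by simp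

end
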